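(* Let $\eta:[0,\infty)\to(0,\infty)$ be a positive function and let $-1<\alpha<0$. Suppose that every real-valued slowly decreasing function $\tau\in L^{1}_{loc}[0,\infty)$ whose Laplace transform $$\mathcal{L}\{\tau;s\}=\int_{0}^{\infty}\tau(x)e^{-sx}\,\mathrm{d}x$$ converges for $\operatorname{Re} s>0$ and has an analytic continuation to the half-plane $\operatorname{Re} s>\alpha$ satisfies $$\tau(x)=O(\eta(x))\qquad (x\to\infty),$$ where the $O$-constant may depend on $\tau$. Then $\eta(x)=\Omega(1)$ as $x\to\infty$, that is, $\eta(x)$ does not tend to $0$ as $x\to\infty$.
   Context: A real-valued function $\tau$ on $[0,\infty)$ is called slowly decreasing if for each $\varepsilon>0$ there is $\delta>0$ such that $$\liminf_{x\to\infty}\ \inf_{h\in[0,\delta]}\bigl(\tau(x+h)-\tau(x)\bigr)>-\varepsilon.$$ The symbol $\Omega$ is the Hardy-Littlewood symbol, i.e. the negation of Landau's $o$: $\eta(x)=\Omega(1)$ means that $\eta(x)=o(1)$ as $x\to\infty$ fails, i.e. $\limsup_{x\to\infty}\eta(x)>0$. $L^{1}_{loc}[0,\infty)$ denotes the functions that are Lebesgue integrable on every compact subset of $[0,\infty)$. *)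

theory Defs
  imports "HOL-Complex_Analysis.Complex_Analysis" "HOL-Library.Landau_Symbols"
begin

text \<open>
  Functions on \<open>[0, \<infinity>)\<close> are represented by total functions on the reals; every notion below
  depends only on their values at nonnegative arguments.
\<close>

text \<open>The infimum and the lower limit are taken in the extended reals, as both may be infinite.\<close>

definition slowly_decreasing :: "(real \<Rightarrow> real) \<Rightarrow> bool" where
  "slowly_decreasing \<tau> \<longleftrightarrow>
     (\<forall>\<epsilon>>0. \<exists>\<delta>>0. Liminf at_top (\<lambda>x. INF h\<in>{0..\<delta>}. ereal (\<tau> (x + h) - \<tau> x)) > ereal (- \<epsilon>))"

definition locally_integrable_on_nonneg :: "(real \<Rightarrow> real) \<Rightarrow> bool" where
  "locally_integrable_on_nonneg \<tau> \<longleftrightarrow>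
     (\<forall>K. compact K \<and> K \<subseteq> {0..} \<longrightarrow> set_integrable lebesgue K \<tau>)"

definition truncated_laplace :: "(real \<Rightarrow> real) \<Rightarrow> complex \<Rightarrow> real \<Rightarrow> complex" where
  "truncated_laplace \<tau> s T =
     (LINT x:{0..T}|lebesgue. complex_of_real (\<tau> x) * exp (- s * complex_of_real x))"

text \<open>The Laplace integral is an improper integral; absolute convergence is not required.\<close>

definition laplace_converges :: "(real \<Rightarrow> real) \<Rightarrow> complex \<Rightarrow> bool" where
  "laplace_converges \<tau> s \<longleftrightarrow> (\<exists>l. (truncated_laplace \<tau> s \<longlongrightarrow> l) at_top)"

definition laplace :: "(real \<Rightarrow> real) \<Rightarrow> complex \<Rightarrow> complex" where
  "laplace \<tau> s = Lim at_top (truncated_laplace \<tau> s)"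

text \<open>Meaningful for \<open>\<alpha> \<le> 0\<close> and a transform converging for \<open>Re s > 0\<close>.\<close>

definition laplace_continues_to :: "(real \<Rightarrow> real) \<Rightarrow> real \<Rightarrow> bool" where
  "laplace_continues_to \<tau> \<alpha> \<longleftrightarrow>
     (\<exists>F. F analytic_on {s. Re s > \<alpha>} \<and> (\<forall>s. Re s > 0 \<longrightarrow> F s = laplace \<tau> s))"

text \<open>
  The Hardy--Littlewood symbol, i.e. the negation of Landau's little-o. It is weaker than the
  library's \<open>\<Omega>\<close>, which is Knuth's symbol and demands an eventual lower bound.
\<close>

definition hardy_littlewood_Omega :: "(real \<Rightarrow> real) \<Rightarrow> (real \<Rightarrow> real) \<Rightarrow> bool" where
  "hardy_littlewood_Omega f g \<longleftrightarrow> f \<notin> o[at_top](g)"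

lemma hardy_littlewood_Omega_1_iff:
  "hardy_littlewood_Omega f (\<lambda>_. 1) \<longleftrightarrow> \<not> (f \<longlongrightarrow> 0) at_top"
  unfolding hardy_littlewood_Omega_def by (auto intro: smalloI_tendsto dest: smalloD_tendsto)

end

theory Submission imports Defs begin

text \<open>
  If \<open>\<eta>\<close> tended to 0, choose integers \<open>m k > k\<close> with \<open>\<eta> (m k) < 8\<^sup>-\<^sup>k\<close> and let \<open>\<tau>\<close> be the sum of the
  packets \<open>4\<^sup>-\<^sup>k b\<^sub>k(x) cos (2 \<pi> k x)\<close>, where the bump \<open>b\<^sub>k\<close> is \<open>x\<^bsup>m k\<^esup> e\<^sup>-\<^sup>x\<close> normalised to have maximum 1
  at \<open>x = m k\<close>. The weights beat the frequencies, so \<open>\<tau>\<close> is Lipschitz; since every cosine equals 1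
  at an integer, \<open>\<tau> (m k) \<ge> 4\<^sup>-\<^sup>k\<close>, which is not \<open>O(\<eta> (m k))\<close>. The transform of \<open>b\<^sub>k(x) cos (2 \<pi> k x)\<close>
  has its only poles at \<open>-1 \<plusminus> 2 \<pi> i k\<close> and is at most 1 where both poles are at distance at least
  \<open>3 > e\<close>. As the frequencies increase to infinity, the transforms sum locally uniformly on
  \<open>Re s > -1\<close>.
\<close>

section \<open>Normalised bumps: bounds and Lipschitz constant\<close>

text \<open>For \<open>m > 0\<close> this is \<open>(exp 1 / m) ^ m * x ^ m * exp (- x)\<close>.
  Writing it as the \<open>m\<close>-th power of t exp(1 - t) at t = x/m reduces its bounds and its
  Lipschitz constant to those of one fixed function.\<close>

definition gamma_bump :: "nat \<Rightarrow> real \<Rightarrow> real" where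
  "gamma_bump m x = (x / m * exp (1 - x / m)) ^ m"

lemma mult_exp_one_minus_bounds:
  fixes t :: real
  assumes "0 \<le> t"
  shows "0 \<le> t * exp (1 - t)" "t * exp (1 - t) \<le> 1"
proof -
  have "t \<le> exp (t - 1)"
    using exp_ge_add_one_self[of "t - 1"] by simp
  then show "t * exp (1 - t) \<le> 1"
    by (simp add: exp_diff field_simps)
qed (use assms in simp)

lemma gamma_bump_bounds:
  assumes "0 \<le> x"
  shows "0 \<le> gamma_bump m x" "gamma_bump m x \<le> 1"
  using mult_exp_one_minus_bounds[of "x / m"] assms
  by (auto simp: gamma_bump_def intro!: power_le_one)

lemma gamma_bump_at_peak: "0 < m \<Longrightarrow> gamma_bump m (real m) = 1"
  by (simp add: gamma_bump_def)

text \<open>The constant does not depend on \<open>m\<close>: on [0,1] the \<open>m\<close>-th power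
  has Lipschitz constant \<open>m\<close>, and the rescaling x/m contributes 1/m. What remains is
  the bound e on the derivative of t exp(1 - t).\<close>

lemma gamma_bump_Lipschitz:
  assumes "0 \<le> x" "0 \<le> y"
  shows "\<bar>gamma_bump m x - gamma_bump m y\<bar> \<le> exp 1 * \<bar>x - y\<bar>"
proof (cases "m = 0")
  case False
  define h where "h = (\<lambda>t::real. t * exp (1 - t))"
  have h: "\<bar>h u - h v\<bar> \<le> exp 1 * \<bar>u - v\<bar>" if "0 \<le> u" "0 \<le> v" for u v
  proof -
    have "(h has_field_derivative (1 - t) * exp (1 - t)) (at t within {0..})" for t
      unfolding h_def by (auto intro!: derivative_eq_intros simp: algebra_simps)
    moreover have "norm ((1 - t) * exp (1 - t)) \<le> exp 1" if "t \<in> {0..}" for t :: real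
    proof -
      \<comment> \<open>For t \<ge> 0, both 1 - t and t - 1 are at most 1 + t, hence at most exp
        t.\<close>
      have "\<bar>1 - t\<bar> \<le> exp t"
        using that exp_ge_add_one_self[of t] unfolding atLeast_iff by linarith
      then have "\<bar>1 - t\<bar> * exp (1 - t) \<le> exp t * exp (1 - t)"
        by (intro mult_right_mono) auto
      then show ?thesis by (simp add: abs_mult flip: exp_add)
    qed
    ultimately show ?thesis
      using field_differentiable_bound[of "{0..}" h "\<lambda>t. (1 - t) * exp (1 - t)" "exp 1" u v] that
      by auto
  qed
  have "\<bar>gamma_bump m x - gamma_bump m y\<bar> \<le> m * \<bar>h (x / m) - h (y / m)\<bar>"
    using norm_power_diff[of "h (x / m)" "h (y / m)" m]
      mult_exp_one_minus_bounds[of "x / m"] mult_exp_one_minus_bounds[of "y / m"] assms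
    by (auto simp: gamma_bump_def h_def)
  also have "\<dots> \<le> m * (exp 1 * \<bar>x / m - y / m\<bar>)"
    using assms by (intro mult_left_mono h) auto
  also have "\<dots> = exp 1 * \<bar>x - y\<bar>"
    using False by (simp add: flip: diff_divide_distrib)
  finally show ?thesis .
qed (simp add: gamma_bump_def)

lemma abs_cos_diff_le: "\<bar>cos x - cos y\<bar> \<le> \<bar>x - y\<bar>" for x y :: real
  using field_differentiable_bound[of UNIV cos "\<lambda>t. - sin t" 1 x y]
  by (auto intro!: derivative_eq_intros)

section \<open>Wave packets\<close>

definition wave_packet :: "nat \<Rightarrow> nat \<Rightarrow> real \<Rightarrow> real" where
  "wave_packet k m x = gamma_bump m x * cos (2 * pi * k * x)"

lemma abs_wave_packet_le_1: "0 \<le> x \<Longrightarrow> \<bar>wave_packet k m x\<bar> \<le> 1"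
  using gamma_bump_bounds[of x m] mult_mono[of "gamma_bump m x" 1 "\<bar>cos (2 * pi * k * x)\<bar>" 1]
  by (simp add: wave_packet_def abs_mult)

lemma wave_packet_at_nat: "wave_packet k m (real n) = gamma_bump m (real n)"
  using cos_npi[of "2 * k * n"] by (simp add: wave_packet_def mult_ac)

text \<open>Product rule for differences. The bound grows only linearly in the frequency and is
  independent of \<open>m\<close>, so the peaks may later be placed as far out as
  \<open>\<eta>\<close> demands.\<close>

lemma wave_packet_Lipschitz:
  assumes "0 \<le> x" "0 \<le> y"
  shows "\<bar>wave_packet k m x - wave_packet k m y\<bar> \<le> (exp 1 + 2 * pi * k) * \<bar>x - y\<bar>"
proof -
  let ?c = "\<lambda>x. cos (2 * pi * k * x)"
  have "wave_packet k m x - wave_packet k m y =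
      (gamma_bump m x - gamma_bump m y) * ?c x + gamma_bump m y * (?c x - ?c y)"
    by (simp add: wave_packet_def algebra_simps)
  also have "\<bar>\<dots>\<bar> \<le> \<bar>gamma_bump m x - gamma_bump m y\<bar> * \<bar>?c x\<bar> + \<bar>gamma_bump m y\<bar> * \<bar>?c x - ?c y\<bar>"
    using abs_triangle_ineq by (metis abs_mult)
  also have "\<dots> \<le> exp 1 * \<bar>x - y\<bar> * 1 + 1 * \<bar>2 * pi * k * x - 2 * pi * k * y\<bar>"
    using gamma_bump_Lipschitz[of x y m] gamma_bump_bounds[of y m] assms
    by (intro add_mono mult_mono abs_cos_diff_le) auto
  also have "\<dots> = (exp 1 + 2 * pi * k) * \<bar>x - y\<bar>"
    by (simp add: abs_mult ring_distribs flip: right_diff_distrib)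
  finally show ?thesis .
qed

lemma continuous_on_wave_packet: "continuous_on A (wave_packet k m)"
  unfolding wave_packet_def gamma_bump_def
  by (cases "m = 0") (auto intro!: continuous_intros)

section \<open>Laplace integrals of powers at complex arguments\<close>

lemma power_mult_exp_tendsto_0:
  fixes w :: complex
  assumes "0 < Re w"
  shows "((\<lambda>x. of_real x ^ m * exp (- w * of_real x)) \<longlongrightarrow> 0) at_top"
proof (rule tendsto_norm_zero_cancel)
  \<comment> \<open>The substitution y = (Re w) x reduces the modulus to y^m / exp y, which tends to
    0.\<close>
  have "((\<lambda>x. (1 / Re w) ^ m * ((Re w * x) ^ m / exp (Re w * x))) \<longlongrightarrow> (1 / Re w) ^ m * 0) at_top"
    using assms
    by (intro tendsto_mult tendsto_const filterlim_compose[OF tendsto_power_div_exp_0]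
        filterlim_tendsto_pos_mult_at_top[OF tendsto_const] filterlim_ident)
  also have "(\<lambda>x. (1 / Re w) ^ m * ((Re w * x) ^ m / exp (Re w * x))) = (\<lambda>x. x ^ m * exp (- Re w * x))"
    using assms by (auto simp: fun_eq_iff power_mult_distrib power_divide exp_minus field_simps)
  finally have "((\<lambda>x. x ^ m * exp (- Re w * x)) \<longlongrightarrow> 0) at_top" by simp
  moreover have "\<forall>\<^sub>F x in at_top.
      x ^ m * exp (- Re w * x) = norm (of_real x ^ m * exp (- w * of_real x))"
    using eventually_ge_at_top[of 0]
    by eventually_elim (simp add: norm_mult norm_power)
  ultimately show "((\<lambda>x. norm (of_real x ^ m * exp (- w * of_real x))) \<longlongrightarrow> 0) at_top"
    using tendsto_cong by fast
qed

text \<open>The antiderivative is normalised to vanish at infinity, so that \<open>- G 0\<close> is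
  the integral over the half-line. The induction on \<open>m\<close> is integration by
  parts.\<close>

lemma power_mult_exp_antiderivative:
  fixes w :: complex
  assumes "0 < Re w"
  shows "\<exists>G. (\<forall>x. (G has_vector_derivative of_real x ^ m * exp (- w * of_real x)) (at x)) \<and>
    (G \<longlongrightarrow> 0) at_top \<and> G (0::real) = - fact m / w ^ Suc m"
proof (induction m)
  case 0
  have w: "w \<noteq> 0" using assms by auto
  have "((\<lambda>x. - exp (- w * of_real x) / w) has_vector_derivative exp (- w * of_real x)) (at x)" for x
    using w by (auto intro!: derivative_eq_intros has_vector_derivative_real_field)
  moreover have "((\<lambda>x. - exp (- w * of_real x) / w) \<longlongrightarrow> - 0 / w) at_top"
    using power_mult_exp_tendsto_0[OF assms, of 0] w by (intro tendsto_intros) auto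
  ultimately show ?case
    by (intro exI[of _ "\<lambda>x. - exp (- w * of_real x) / w"]) auto
next
  case (Suc m)
  have w: "w \<noteq> 0" using assms by auto
  let ?f = "\<lambda>m x. of_real x ^ m * exp (- w * of_real x)"
  obtain G where G: "\<And>x. (G has_vector_derivative ?f m x) (at x)"
    "(G \<longlongrightarrow> 0) at_top" "G (0::real) = - fact m / w ^ Suc m"
    using Suc by auto
  \<comment> \<open>Integrating the derivative of \<open>?f (Suc m)\<close> gives w \<integral>
    f_(m+1) = (m+1) \<integral> f_m - f_(m+1); \<open>H\<close> is this relation solved for the
    integral on the left.\<close>
  define H where "H = (\<lambda>x. (of_nat (Suc m) * G x - ?f (Suc m) x) / w)"
  have f: "(?f (Suc m) has_vector_derivative
      of_nat (Suc m) * ?f m x - w * ?f (Suc m) x) (at x)" for x :: real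
  proof (rule has_vector_derivative_real_field)
    show "((\<lambda>z. z ^ Suc m * exp (- w * z)) has_field_derivative
        of_nat (Suc m) * ?f m x - w * ?f (Suc m) x) (at (of_real x))"
      by (rule DERIV_cong, (rule derivative_intros)+) (simp add: algebra_simps)
  qed
  have "(H has_vector_derivative
      (of_nat (Suc m) * ?f m x - (of_nat (Suc m) * ?f m x - w * ?f (Suc m) x)) / w) (at x)" for x
    unfolding H_def
    by (intro has_vector_derivative_divide has_vector_derivative_diff
        has_vector_derivative_mult_right G f)
  then have "(H has_vector_derivative ?f (Suc m) x) (at x)" for x
    using w by simp
  moreover have "(H \<longlongrightarrow> (of_nat (Suc m) * 0 - 0) / w) at_top"
    unfolding H_def using w
    by (intro tendsto_intros G power_mult_exp_tendsto_0 assms)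
  moreover have "H 0 = - fact (Suc m) / w ^ Suc (Suc m)"
    using w by (simp add: H_def G(3) field_simps)
  ultimately show ?case by (intro exI[of _ H]) simp
qed

lemma set_integrable_exp_bound:
  fixes f :: "real \<Rightarrow> complex"
  assumes "continuous_on {0..} f" "0 < \<sigma>" "\<And>x. 0 \<le> x \<Longrightarrow> norm (f x) \<le> C * exp (- \<sigma> * x)"
  shows "set_integrable lebesgue {0..} f"
proof (rule set_integrable_bound)
  show "set_integrable lebesgue {0..} (\<lambda>x. C * exp (- \<sigma> * x))"
    using integrable_on_exp_minus_to_infinity[OF assms(2), of 0]
    by (intro set_integrable_mult_right nonnegative_absolutely_integrable_1) auto
  show "set_borel_measurable lebesgue {0..} f"
    using continuous_imp_measurable_on_sets_lebesgue[OF assms(1)]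
    by (simp add: set_borel_measurable_def borel_measurable_restrict_space_iff)
  have "norm (f x) \<le> norm (C * exp (- \<sigma> * x))" if "0 \<le> x" for x
    using assms(3)[OF that] by simp
  then show "AE x in lebesgue. x \<in> {0..} \<longrightarrow> norm (f x) \<le> norm (C * exp (- \<sigma> * x))"
    by auto
qed

lemma LINT_power_mult_exp:
  fixes w :: complex
  assumes "0 < Re w"
  shows "set_integrable lebesgue {0..} (\<lambda>x. of_real x ^ m * exp (- w * of_real x))" (is ?A)
    and "(LINT x:{0..}|lebesgue. of_real x ^ m * exp (- w * of_real x)) = fact m / w ^ Suc m"
proof -
  let ?f = "\<lambda>x::real. of_real x ^ m * exp (- w * of_real x)"
  \<comment> \<open>Half of the decay rate absorbs the factor \<open>x ^ m\<close>; the other half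
    is left for integrability.\<close>
  define c where "c = Re w / 2"
  have c: "0 < c" using assms by (simp add: c_def)
  have "norm (?f x) \<le> (m / c) ^ m * exp (- c * x)" if "0 \<le> x" for x
  proof -
    have "x ^ m \<le> (m / c) ^ m * exp (c * x)"
    proof (cases "m = 0")
      case False
      \<comment> \<open>The inequality y \<le> exp y at y = c x / m, to be raised to the
        \<open>m\<close>-th power.\<close>
      have "c * x / m \<le> exp (c * x / m)"
        using exp_ge_add_one_self[of "c * x / m"] by linarith
      then have "x \<le> m / c * exp (c * x / m)"
        using c False by (simp add: field_simps)
      then have "x ^ m \<le> (m / c * exp (c * x / m)) ^ m"
        using that by (rule power_mono)
      also have "\<dots> = (m / c) ^ m * exp (c * x)"
        using False by (simp only: power_mult_distrib flip: exp_of_nat_mult) simp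
      finally show ?thesis .
    qed (use c that in simp)
    then have "x ^ m * exp (- Re w * x) \<le> (m / c) ^ m * exp (c * x) * exp (- Re w * x)"
      by (intro mult_right_mono) auto
    also have "\<dots> = (m / c) ^ m * exp (- c * x)"
      by (simp add: c_def mult.assoc flip: exp_add)
    finally show ?thesis
      using that by (simp add: norm_mult norm_power)
  qed
  then show int: ?A
    by (intro set_integrable_exp_bound[OF _ c]) (auto intro!: continuous_intros)
  obtain G where G: "\<And>x. (G has_vector_derivative ?f x) (at x)"
    "(G \<longlongrightarrow> 0) at_top" "G 0 = - fact m / w ^ Suc m"
    using power_mult_exp_antiderivative[OF assms] by blast
  have "(LINT x:{0..T}|lebesgue. ?f x) = G T - G 0" if "0 \<le> T" for T
  proof -
    have "(?f has_integral G T - G 0) {0..T}"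
      using that G(1) by (intro fundamental_theorem_of_calculus) (auto intro: has_vector_derivative_at_within)
    moreover have "set_integrable lebesgue {0..T} ?f"
      using set_integrable_subset[OF int] by simp
    ultimately show ?thesis
      using set_lebesgue_integral_eq_integral(2) integral_unique by metis
  qed
  \<comment> \<open>The integrals over [0,T] have two limits to compare: \<open>- G 0\<close> by the
    fundamental theorem, and the integral over the half-line by integrability.\<close>
  then have "\<forall>\<^sub>F T in at_top. G T - G 0 = (LINT x:{0..T}|lebesgue. ?f x)"
    by (intro eventually_mono[OF eventually_ge_at_top[of 0]]) metis
  moreover have "((\<lambda>T. G T - G 0) \<longlongrightarrow> 0 - G 0) at_top"
    by (intro tendsto_intros G)
  ultimately have "((\<lambda>T. LINT x:{0..T}|lebesgue. ?f x) \<longlongrightarrow> 0 - G 0) at_top"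
    by (rule Lim_transform_eventually[rotated])
  moreover have "((\<lambda>T. LINT x:{0..T}|lebesgue. ?f x) \<longlongrightarrow> (LINT x:{0..}|lebesgue. ?f x)) at_top"
    using int by (intro tendsto_set_lebesgue_integral_at_top) auto
  ultimately show "(LINT x:{0..}|lebesgue. ?f x) = fact m / w ^ Suc m"
    using tendsto_unique[OF trivial_limit_at_top_linorder] G(3) by fastforce
qed

section \<open>The transform of a single packet\<close>

text \<open>The closed form that continues the transform. The shift by 1 comes from the factor
  exp(-x) of the bump, the imaginary shifts from the two exponentials of the cosine, and (e/m)^m
  from the normalisation.\<close>

definition wave_packet_transform :: "nat \<Rightarrow> nat \<Rightarrow> complex \<Rightarrow> complex" where
  "wave_packet_transform k m s = of_real ((exp 1 / m) ^ m) * fact m / 2 *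
     (1 / (s + 1 - \<i> * of_real (2 * pi * k)) ^ Suc m + 1 / (s + 1 + \<i> * of_real (2 * pi * k)) ^ Suc m)"

lemma LINT_wave_packet:
  assumes "0 < m" "-1 < Re s"
  shows "(LINT x:{0..}|lebesgue. of_real (wave_packet k m x) * exp (- s * of_real x)) =
    wave_packet_transform k m s"
proof -
  define a where "a = s + 1 - \<i> * of_real (2 * pi * k)"
  define b where "b = s + 1 + \<i> * of_real (2 * pi * k)"
  \<comment> \<open>\<open>c\<close> combines the normalisation of the bump with the 1/2 from the
    cosine.\<close>
  define c :: complex where "c = of_real ((exp 1 / m) ^ m) / 2"
  let ?f = "\<lambda>w x. of_real x ^ m * exp (- w * of_real x)"
  have ab: "0 < Re a" "0 < Re b" using assms by (auto simp: a_def b_def)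
  have "of_real (wave_packet k m x) * exp (- s * of_real x) = c * (?f a x + ?f b x)" for x
  proof -
    define u where "u = \<i> * of_real (2 * pi * k * x)"
    have "exp (1 - x / m) ^ m = exp 1 ^ m * exp (- x)"
      using assms by (simp add: algebra_simps flip: exp_of_nat_mult exp_add)
    then have "gamma_bump m x = (exp 1 / m) ^ m * x ^ m * exp (- x)"
      by (simp add: gamma_bump_def power_mult_distrib power_divide)
    then have bump: "complex_of_real (gamma_bump m x) =
        c * 2 * of_real x ^ m * of_real (exp (- x))"
      by (simp add: c_def)
    have cos: "complex_of_real (cos (2 * pi * k * x)) = (exp u + exp (- u)) / 2"
      by (simp add: u_def cos_of_real[symmetric] cos_exp_eq del: of_real_mult)
    have "exp (- a * of_real x) = exp (- s * of_real x) * of_real (exp (- x)) * exp u"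
      "exp (- b * of_real x) = exp (- s * of_real x) * of_real (exp (- x)) * exp (- u)"
      by (simp_all add: a_def b_def u_def algebra_simps exp_of_real[symmetric] flip: exp_add)
    then show ?thesis
      unfolding wave_packet_def of_real_mult bump cos by (simp add: algebra_simps)
  qed
  then have "(LINT x:{0..}|lebesgue. of_real (wave_packet k m x) * exp (- s * of_real x)) =
      c * (fact m / a ^ Suc m + fact m / b ^ Suc m)"
    using LINT_power_mult_exp[OF ab(1), of m] LINT_power_mult_exp[OF ab(2), of m]
    by (simp only: set_integral_mult_right set_integral_add)
  also have "\<dots> = wave_packet_transform k m s"
    unfolding wave_packet_transform_def a_def[symmetric] b_def[symmetric]
    by (simp add: c_def ring_distribs)
  finally show ?thesis .
qed

lemma holomorphic_on_wave_packet_transform: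
  "wave_packet_transform k m holomorphic_on {s. - 1 < Re s}"
  unfolding wave_packet_transform_def
  by (intro holomorphic_intros power_not_zero) (auto simp: complex_eq_iff)

text \<open>By m! \<le> m^m the prefactor is at most e^m / 2 \<le> 3^m / 2, while each fraction is
  at most 3^-(m+1). The exponentials in \<open>m\<close> cancel, so the bound is uniform in the
  position of the peak.\<close>

lemma norm_wave_packet_transform_le_1:
  assumes "0 < m" "norm (s + 1) + 3 \<le> real k"
  shows "norm (wave_packet_transform k m s) \<le> 1"
proof -
  define \<omega> where "\<omega> = \<i> * complex_of_real (2 * pi * k)"
  \<comment> \<open>Since 2 pi \<ge> 1, the imaginary shift has modulus at least \<open>k\<close>,
    so it exceeds \<open>norm (s + 1)\<close> by at least 3.\<close>
  have "real k * 1 \<le> real k * (2 * pi)"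
    using pi_gt3 by (intro mult_left_mono) auto
  then have "norm (s + 1) + 3 \<le> norm \<omega>"
    using assms by (simp add: \<omega>_def norm_mult mult_ac)
  then have "3 \<le> norm (s + 1 - \<omega>)" "3 \<le> norm (s + 1 + \<omega>)"
    using norm_triangle_ineq2[of \<omega> "s + 1"] norm_diff_ineq[of \<omega> "s + 1"]
    by (auto simp: norm_minus_commute add.commute)
  then have inv: "norm (1 / (s + 1 - \<omega>) ^ Suc m) \<le> 1 / 3 ^ Suc m"
    "norm (1 / (s + 1 + \<omega>) ^ Suc m) \<le> 1 / 3 ^ Suc m"
    unfolding norm_divide norm_power norm_one
    by (intro divide_left_mono power_mono mult_pos_pos zero_less_power; linarith)+
  have "(exp 1 / m) ^ m * fact m \<le> (exp 1 / m) ^ m * real m ^ m"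
    using fact_le_power[of m, where 'a = real] by (intro mult_left_mono) auto
  also have "\<dots> = exp 1 ^ m"
    using assms(1) by (simp add: power_divide)
  also have "\<dots> \<le> 3 ^ m"
    using exp_le by (intro power_mono) auto
  finally have fact: "(exp 1 / m) ^ m * fact m \<le> (3 ^ m :: real)" .
  have "norm (wave_packet_transform k m s) = (exp 1 / m) ^ m * fact m / 2 *
      norm (1 / (s + 1 - \<omega>) ^ Suc m + 1 / (s + 1 + \<omega>) ^ Suc m)"
    by (simp only: wave_packet_transform_def flip: \<omega>_def) (simp add: norm_mult norm_power norm_divide)
  also have "\<dots> \<le> 3 ^ m / 2 * (1 / 3 ^ Suc m + 1 / 3 ^ Suc m)"
    using fact by (intro mult_mono order.trans[OF norm_triangle_ineq] add_mono inv) auto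
  also have "\<dots> \<le> 1" by simp
  finally show ?thesis .
qed

section \<open>The sum of the packets\<close>

text \<open>The weight 4^-k still yields a convergent series against Lipschitz constants of order
  2^k, yet dominates 8^-k. Nothing is claimed at negative arguments.\<close>

definition packet_sum :: "(nat \<Rightarrow> nat) \<Rightarrow> real \<Rightarrow> real" where
  "packet_sum m x = (\<Sum>k. (1/4) ^ k * wave_packet k (m k) x)"

lemma summable_packet_sum:
  assumes "0 \<le> x"
  shows "summable (\<lambda>k. (1/4) ^ k * wave_packet k (m k) x)"
proof (rule summable_comparison_test')
  show "summable (\<lambda>k. (1/4 :: real) ^ k)"
    by (simp add: summable_geometric)
  show "norm ((1/4) ^ k * wave_packet k (m k) x) \<le> (1/4) ^ k" for k
    using abs_wave_packet_le_1[OF assms, of k "m k"] by (simp add: abs_mult mult_left_le power_divide divide_right_mono)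
qed

lemma packet_sum_Lipschitz:
  assumes "0 \<le> x" "0 \<le> y"
  shows "\<bar>packet_sum m x - packet_sum m y\<bar> \<le> 2 * (exp 1 + 2 * pi) * \<bar>x - y\<bar>"
proof -
  let ?L = "exp 1 + 2 * pi :: real"
  have "packet_sum m x - packet_sum m y =
      (\<Sum>k. (1/4) ^ k * wave_packet k (m k) x - (1/4) ^ k * wave_packet k (m k) y)"
    unfolding packet_sum_def using assms by (intro suminf_diff summable_packet_sum)
  also have "norm \<dots> \<le> (\<Sum>k. ?L * \<bar>x - y\<bar> * (1/2) ^ k)"
  proof (rule norm_suminf_le)
    fix k
    have "norm ((1/4) ^ k * wave_packet k (m k) x - (1/4) ^ k * wave_packet k (m k) y)
        = (1/4) ^ k * \<bar>wave_packet k (m k) x - wave_packet k (m k) y\<bar>"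
      by (simp add: abs_mult flip: right_diff_distrib)
    also have "\<dots> \<le> (1/4) ^ k * ((exp 1 + 2 * pi * k) * \<bar>x - y\<bar>)"
      using assms by (intro mult_left_mono wave_packet_Lipschitz) auto
    also have "\<dots> \<le> (1/4) ^ k * ((?L * 2 ^ k) * \<bar>x - y\<bar>)"
    proof -
      \<comment> \<open>The crude bound k \<le> 2^k suffices: against 4^-k it leaves a geometric
        series of ratio 1/2, whose sum is the factor 2 in the statement.\<close>
      have "real k \<le> 2 ^ k"
        using less_exp[of k] by (metis less_imp_le of_nat_le_iff of_nat_numeral of_nat_power)
      then have "exp 1 * 1 + 2 * pi * real k \<le> exp 1 * 2 ^ k + 2 * pi * 2 ^ k"
        by (intro add_mono mult_left_mono) auto
      then show ?thesis
        by (intro mult_left_mono mult_right_mono) (auto simp: ring_distribs)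
    qed
    also have "\<dots> = ?L * \<bar>x - y\<bar> * ((1/4) ^ k * 2 ^ k)"
      by (simp only: mult_ac)
    also have "(1/4) ^ k * 2 ^ k = (1/2 :: real) ^ k"
      by (simp flip: power_mult_distrib)
    finally show "norm ((1/4) ^ k * wave_packet k (m k) x - (1/4) ^ k * wave_packet k (m k) y)
        \<le> ?L * \<bar>x - y\<bar> * (1/2) ^ k" .
  qed (simp add: summable_geometric)
  also have "\<dots> = 2 * ?L * \<bar>x - y\<bar>"
    by (subst suminf_mult) (simp_all add: summable_geometric suminf_geometric)
  finally show ?thesis by simp
qed

lemma continuous_on_packet_sum: "continuous_on {0..} (packet_sum m)"
proof -
  have "(2 * (exp 1 + 2 * pi))-lipschitz_on {0..} (packet_sum m)"
    using packet_sum_Lipschitz by (intro lipschitz_onI) (auto simp: dist_real_def)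
  then show ?thesis by (rule lipschitz_on_continuous_on)
qed

section \<open>Slow decrease and local integrability\<close>

lemma slowly_decreasing_if_Lipschitz:
  assumes "\<And>x y. 0 \<le> x \<Longrightarrow> 0 \<le> y \<Longrightarrow> \<bar>f x - f y\<bar> \<le> L * \<bar>x - y\<bar>"
  shows "slowly_decreasing f"
  unfolding slowly_decreasing_def
proof (intro allI impI)
  fix \<epsilon> :: real
  assume "0 < \<epsilon>"
  have "0 \<le> L" using assms[of 0 1] by simp
  \<comment> \<open>\<open>L + 1\<close> avoids division by zero when \<open>L = 0\<close>; the
    factor 2 keeps the lower limit strictly above \<open>- \<epsilon>\<close>.\<close>
  define \<delta> where "\<delta> = \<epsilon> / (2 * (L + 1))"
  have \<delta>: "0 < \<delta>" "L * \<delta> \<le> \<epsilon> / 2"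
    using \<open>0 < \<epsilon>\<close> \<open>0 \<le> L\<close> by (auto simp: \<delta>_def field_simps)
  have "ereal (- (\<epsilon> / 2)) \<le> ereal (f (x + h) - f x)" if "0 \<le> x" "h \<in> {0..\<delta>}" for x h
  proof -
    have "\<bar>f (x + h) - f x\<bar> \<le> L * h"
      using assms[of "x + h" x] that by simp
    also have "\<dots> \<le> L * \<delta>"
      using that \<open>0 \<le> L\<close> by (intro mult_left_mono) auto
    finally show ?thesis using \<delta> by simp
  qed
  then have "\<forall>\<^sub>F x in at_top. ereal (- (\<epsilon> / 2)) \<le> (INF h\<in>{0..\<delta>}. ereal (f (x + h) - f x))"
    by (intro eventually_mono[OF eventually_ge_at_top[of 0]] INF_greatest)
  then have "ereal (- (\<epsilon> / 2)) \<le> Liminf at_top (\<lambda>x. INF h\<in>{0..\<delta>}. ereal (f (x + h) - f x))"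
    by (rule Liminf_bounded)
  moreover have "ereal (- \<epsilon>) < ereal (- (\<epsilon> / 2))"
    using \<open>0 < \<epsilon>\<close> by simp
  ultimately show "\<exists>\<delta>>0. ereal (- \<epsilon>) < Liminf at_top (\<lambda>x. INF h\<in>{0..\<delta>}. ereal (f (x + h) - f x))"
    using \<delta>(1) less_le_trans by blast
qed

lemma locally_integrable_on_nonneg_continuous:
  assumes "continuous_on {0..} f"
  shows "locally_integrable_on_nonneg f"
  unfolding locally_integrable_on_nonneg_def
proof (intro allI impI)
  fix K :: "real set"
  assume K: "compact K \<and> K \<subseteq> {0..}"
  then obtain b where "\<And>x. x \<in> K \<Longrightarrow> \<bar>x\<bar> \<le> b"
    using compact_imp_bounded[of K] by (auto simp: bounded_iff)
  then have "K \<subseteq> {0..b}" using K by (auto simp: abs_le_iff)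
  moreover have "set_integrable lebesgue {0..b} f"
    using assms by (intro absolutely_integrable_continuous_real) (auto elim: continuous_on_subset)
  moreover have "K \<in> sets lebesgue"
    using K by (simp add: borel_compact)
  ultimately show "set_integrable lebesgue K f"
    using set_integrable_subset by blast
qed

section \<open>The transform of the sum and its continuation\<close>

definition packet_sum_transform :: "(nat \<Rightarrow> nat) \<Rightarrow> complex \<Rightarrow> complex" where
  "packet_sum_transform m s = (\<Sum>k. (1/4) ^ k * wave_packet_transform k (m k) s)"

text \<open>Termwise integration: the \<open>k\<close>-th integrand is dominated by 4^-k exp(-(Re s)
  x), integrable because Re s > 0. The Laplace integral even converges absolutely, so its
  truncations converge to the full integral.\<close>

lemma tendsto_truncated_laplace_packet_sum:
  assumes m: "\<And>k. 0 < m k" and s: "0 < Re s"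
  shows "(truncated_laplace (packet_sum m) s \<longlongrightarrow> packet_sum_transform m s) at_top"
proof -
  \<comment> \<open>The cutoff to the half-line is built into \<open>g\<close>, so that the theorems
    on series of integrable functions over the whole space apply.\<close>
  define g where "g k x = indicator {0..} x *\<^sub>R
    (of_real ((1/4) ^ k) * (of_real (wave_packet k (m k) x) * exp (- s * of_real x)))"
    for k and x :: real
  let ?e = "\<lambda>x. exp (- Re s * x) :: real"
  have g_le: "norm (g k x) \<le> (1/4) ^ k * (indicator {0..} x *\<^sub>R ?e x)" for k x
  proof (cases "0 \<le> x")
    case True
    have "norm (g k x) = (1/4) ^ k * (\<bar>wave_packet k (m k) x\<bar> * ?e x)"
      using True by (simp add: g_def norm_mult norm_power norm_divide)
    also have "\<dots> \<le> (1/4) ^ k * (1 * ?e x)"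
      by (intro mult_left_mono mult_right_mono abs_wave_packet_le_1 True) auto
    finally show ?thesis using True by simp
  qed (simp add: g_def)
  have int_e: "integrable lebesgue (\<lambda>x. indicator {0..} x *\<^sub>R ?e x)"
    using nonnegative_absolutely_integrable_1[OF integrable_on_exp_minus_to_infinity[OF s, of 0]]
    by (simp add: set_integrable_def)
  have int_g: "integrable lebesgue (g k)" for k
    unfolding g_def set_integrable_def[symmetric]
  proof (intro set_integrable_mult_right set_integrable_exp_bound[OF _ s, where C = 1])
    show "continuous_on {0..} (\<lambda>x. of_real (wave_packet k (m k) x) * exp (- s * of_real x))"
      by (intro continuous_intros continuous_on_wave_packet)
    show "norm (of_real (wave_packet k (m k) x) * exp (- s * of_real x)) \<le> 1 * exp (- Re s * x)"
      if "0 \<le> x" for x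
      using abs_wave_packet_le_1[OF that, of k "m k"] by (simp add: norm_mult mult_right_mono)
  qed
  have geom: "summable (\<lambda>k. (1/4) ^ k * c)" for c :: real
    by (intro summable_mult2) (simp add: summable_geometric)
  have sum_g: "summable (\<lambda>k. norm (g k x))" for x
    using g_le by (intro summable_comparison_test'[OF geom]) auto
  have sum_int: "summable (\<lambda>k. LINT x|lebesgue. norm (g k x))"
  proof (rule summable_comparison_test'[OF geom])
    fix k
    have "(LINT x|lebesgue. norm (g k x)) \<le> (LINT x|lebesgue. (1/4) ^ k * (indicator {0..} x *\<^sub>R ?e x))"
      using int_g int_e g_le by (intro integral_mono) auto
    then show "norm (LINT x|lebesgue. norm (g k x)) \<le>
        (1/4) ^ k * (LINT x|lebesgue. indicator {0..} x *\<^sub>R ?e x)"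
      by simp
  qed
  have g_suminf: "(\<Sum>k. g k x) =
      indicator {0..} x *\<^sub>R (of_real (packet_sum m x) * exp (- s * of_real x))" for x
  proof (cases "0 \<le> x")
    case True
    have "(\<lambda>k. of_real ((1/4) ^ k * wave_packet k (m k) x) * exp (- s * of_real x))
        sums (of_real (packet_sum m x) * exp (- s * of_real x))"
      unfolding packet_sum_def by (intro sums_mult2 sums_of_real summable_sums summable_packet_sum True)
    then show ?thesis
      using True by (auto simp: g_def sums_iff mult.assoc)
  qed (simp add: g_def)
  have AE: "AE x in lebesgue. summable (\<lambda>k. norm (g k x))"
    using sum_g by simp
  have "set_integrable lebesgue {0..} (\<lambda>x. of_real (packet_sum m x) * exp (- s * of_real x))"
    using integrable_suminf[OF int_g AE sum_int] by (simp only: g_suminf set_integrable_def)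
  then have "((\<lambda>T. LINT x:{0..T}|lebesgue. of_real (packet_sum m x) * exp (- s * of_real x)) \<longlongrightarrow>
      (LINT x:{0..}|lebesgue. of_real (packet_sum m x) * exp (- s * of_real x))) at_top"
    by (intro tendsto_set_lebesgue_integral_at_top) auto
  moreover have "(LINT x:{0..}|lebesgue. of_real (packet_sum m x) * exp (- s * of_real x)) =
      (\<Sum>k. integral\<^sup>L lebesgue (g k))"
    using integral_suminf[OF int_g AE sum_int] by (simp only: g_suminf set_lebesgue_integral_def)
  moreover have "integral\<^sup>L lebesgue (g k) = (1/4) ^ k * wave_packet_transform k (m k) s" for k
  proof -
    have "integral\<^sup>L lebesgue (g k) = (LINT x:{0..}|lebesgue.
        of_real ((1/4) ^ k) * (of_real (wave_packet k (m k) x) * exp (- s * of_real x)))"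
      by (simp only: g_def[abs_def] set_lebesgue_integral_def)
    also have "\<dots> = of_real ((1/4) ^ k) * wave_packet_transform k (m k) s"
      using s by (subst LINT_wave_packet[OF m, symmetric]) (simp, simp only: set_integral_mult_right)
    finally show ?thesis by simp
  qed
  ultimately show ?thesis
    by (simp add: truncated_laplace_def[abs_def] packet_sum_transform_def)
qed

text \<open>The partial sums converge uniformly on closed discs. Near Re s = -1 the early terms may
  be large, but on each disc only finitely many escape the bound 4^-k.\<close>

lemma holomorphic_on_packet_sum_transform:
  assumes "\<And>k. 0 < m k"
  shows "packet_sum_transform m holomorphic_on {s. - 1 < Re s}"
proof (rule holomorphic_uniform_sequence)
  let ?S = "{s. - 1 < Re s}"
  show S: "open ?S" by (rule open_halfspace_Re_gt)
  show "(\<lambda>s. \<Sum>k<n. (1/4) ^ k * wave_packet_transform k (m k) s) holomorphic_on ?S" for n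
    by (intro holomorphic_intros holomorphic_on_wave_packet_transform)
  fix s
  assume "s \<in> ?S"
  then obtain d where d: "0 < d" "cball s d \<subseteq> ?S"
    using S open_contains_cball by blast
  \<comment> \<open>The radius \<open>d\<close> is added because \<open>norm (z + 1)\<close> is at
    most \<open>norm (s + 1) + d\<close> on the disc, so one threshold for \<open>k\<close> serves
    all its points.\<close>
  have "\<forall>\<^sub>F k in sequentially. norm (s + 1) + d + 3 \<le> real k"
    using filterlim_real_sequentially by (simp add: filterlim_at_top)
  then have "\<forall>\<^sub>F k in sequentially. \<forall>z\<in>cball s d.
      norm ((1/4) ^ k * wave_packet_transform k (m k) z) \<le> (1/4) ^ k"
  proof eventually_elim
    case (elim k)
    show ?case
    proof
      fix z
      assume "z \<in> cball s d"
      then have "norm (z + 1) + 3 \<le> real k"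
        using elim norm_triangle_ineq[of "z - s" "s + 1"] by (simp add: dist_norm norm_minus_commute)
      then have "norm (wave_packet_transform k (m k) z) \<le> 1"
        using assms by (intro norm_wave_packet_transform_le_1)
      then show "norm ((1/4) ^ k * wave_packet_transform k (m k) z) \<le> (1/4) ^ k"
        by (simp add: norm_mult norm_power norm_divide mult_left_le power_divide divide_right_mono)
    qed
  qed
  then have "uniform_limit (cball s d) (\<lambda>n s. \<Sum>k<n. (1/4) ^ k * wave_packet_transform k (m k) s)
      (packet_sum_transform m) sequentially"
    unfolding packet_sum_transform_def
    by (rule Weierstrass_m_test_ev) (simp add: summable_geometric)
  then show "\<exists>d>0. cball s d \<subseteq> ?S \<and> uniform_limit (cball s d)
      (\<lambda>n s. \<Sum>k<n. (1/4) ^ k * wave_packet_transform k (m k) s) (packet_sum_transform m) sequentially"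
    using d by blast
qed

section \<open>Lower bound at the peaks and the contradiction\<close>

text \<open>At an integer all cosines equal 1, so every term is nonnegative and no cancellation can
  occur; the \<open>k\<close>-th term alone, taken at its peak, gives the bound.\<close>

lemma packet_sum_ge:
  assumes "0 < m k"
  shows "(1/4) ^ k \<le> packet_sum m (real (m k))"
proof -
  have "(\<Sum>j\<in>{k}. (1/4) ^ j * wave_packet j (m j) (real (m k))) \<le> packet_sum m (real (m k))"
    unfolding packet_sum_def
    by (intro sum_le_suminf summable_packet_sum) (auto simp: wave_packet_at_nat gamma_bump_bounds)
  then show ?thesis
    using assms by (simp add: wave_packet_at_nat gamma_bump_at_peak)
qed

theorem theorem4:
  fixes \<eta> :: "real \<Rightarrow> real" and \<alpha> :: real
  assumes "\<And>x. x \<ge> 0 \<Longrightarrow> \<eta> x > 0"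
    and "- 1 < \<alpha>" and "\<alpha> < 0"
    and "\<And>\<tau> :: real \<Rightarrow> real. slowly_decreasing \<tau> \<Longrightarrow> locally_integrable_on_nonneg \<tau> \<Longrightarrow>
           (\<And>s. Re s > 0 \<Longrightarrow> laplace_converges \<tau> s) \<Longrightarrow> laplace_continues_to \<tau> \<alpha> \<Longrightarrow>
           \<tau> \<in> O[at_top](\<eta>)"
  shows "hardy_littlewood_Omega \<eta> (\<lambda>_. 1)"
  unfolding hardy_littlewood_Omega_1_iff
proof
  assume lim: "(\<eta> \<longlongrightarrow> 0) at_top"
  \<comment> \<open>The condition \<open>n > k\<close> makes the chosen peaks positive and forces
    them to infinity.\<close>
  have "\<exists>n>k. \<eta> (real n) < (1/8) ^ k" for k
  proof -
    have "((\<lambda>n. \<eta> (real n)) \<longlonglongrightarrow> 0)"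
      by (rule filterlim_compose[OF lim filterlim_real_sequentially])
    then have "\<forall>\<^sub>F n in sequentially. \<eta> (real n) < (1/8) ^ k"
      by (rule order_tendstoD) simp
    then have "\<forall>\<^sub>F n in sequentially. k < n \<and> \<eta> (real n) < (1/8) ^ k"
      using eventually_gt_at_top by (rule eventually_conj[rotated])
    then show ?thesis
      using eventually_happens'[OF sequentially_bot] by fastforce
  qed
  then obtain m where m: "\<And>k. k < m k" "\<And>k. \<eta> (real (m k)) < (1/8) ^ k"
    by metis
  have m_pos: "0 < m k" for k
    using m(1)[of k] by simp
  let ?\<tau> = "packet_sum m"
  have "laplace_converges ?\<tau> s" if "0 < Re s" for s
    using tendsto_truncated_laplace_packet_sum[of m, OF m_pos that] unfolding laplace_converges_def by blast
  moreover have "laplace_continues_to ?\<tau> \<alpha>"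
    unfolding laplace_continues_to_def
  proof (intro exI conjI allI impI)
    \<comment> \<open>Since \<open>- 1 < \<alpha>\<close>, the required half-plane lies inside the
      one where the series is holomorphic.\<close>
    have "packet_sum_transform m holomorphic_on {s. \<alpha> < Re s}"
      using assms(2) by (intro holomorphic_on_subset[OF holomorphic_on_packet_sum_transform] m_pos) auto
    then show "packet_sum_transform m analytic_on {s. \<alpha> < Re s}"
      by (simp add: analytic_on_open open_halfspace_Re_gt)
    show "packet_sum_transform m s = laplace ?\<tau> s" if "0 < Re s" for s
      unfolding laplace_def
      using tendsto_Lim[OF _ tendsto_truncated_laplace_packet_sum[of m, OF m_pos that]] by simp
  qed
  ultimately have "?\<tau> \<in> O[at_top](\<eta>)"
    using slowly_decreasing_if_Lipschitz[OF packet_sum_Lipschitz]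
      locally_integrable_on_nonneg_continuous[OF continuous_on_packet_sum] assms(4) by blast
  then obtain C where C: "0 < C" "\<forall>\<^sub>F x in at_top. norm (?\<tau> x) \<le> C * norm (\<eta> x)"
    by (auto elim: landau_o.bigE)
  \<comment> \<open>As the peaks tend to infinity, the eventual O-bound can be evaluated along
    them.\<close>
  have "filterlim (\<lambda>k. real (m k)) at_top sequentially"
    by (rule filterlim_at_top_mono[OF filterlim_real_sequentially])
      (simp add: m(1) less_imp_le)
  then have "\<forall>\<^sub>F k in sequentially. norm (?\<tau> (real (m k))) \<le> C * norm (\<eta> (real (m k)))"
    using C(2) eventually_compose_filterlim by fast
  \<comment> \<open>At the peaks the O-bound reads 4^-k \<le> C 8^-k, that is 1/C \<le> 2^-k, which
    fails for large \<open>k\<close>.\<close>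
  moreover have "\<forall>\<^sub>F k in sequentially. (1/2) ^ k < 1 / C"
    using C(1) by (intro order_tendstoD(2)[OF LIMSEQ_power_zero]) auto
  ultimately have "\<forall>\<^sub>F k::nat in sequentially. False"
  proof eventually_elim
    case (elim k)
    have "(1/4) ^ k \<le> C * norm (\<eta> (real (m k)))"
      using packet_sum_ge[of m k, OF m_pos] elim(1) by simp
    also have "\<dots> \<le> C * (1/8) ^ k"
      using C(1) m(2)[of k] assms(1)[of "real (m k)"] by (intro mult_left_mono) auto
    also have "(1/8 :: real) ^ k = (1/4) ^ k * (1/2) ^ k"
      by (simp flip: power_mult_distrib)
    finally have "1 / C \<le> (1/2) ^ k"
      using C(1) by (simp add: field_simps)
    then show False using elim(2) by simp
  qed
  then show False by simp
qed

end
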